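(* Let $A\in\mathbb{R}^{d\times d}$, $B\in\mathbb{R}^{d\times n}$, $\rho>0$, and let $M=\begin{bmatrix} Q & S^*\\ S & R\end{bmatrix}$ be a symmetric $(d+n)\times(d+n)$ real matrix with $Q=Q^*\in\mathbb{R}^{d\times d}$, $S\in\mathbb{R}^{n\times d}$, $R=R^*\in\mathbb{R}^{n\times n}$. If there exist $N\in\mathbb{R}^{n\times d}$ and $\varepsilon\in[0,2/\|R\|]$ such that $A+B(I+\varepsilon R)N+\varepsilon BS$ is $\rho$-Schur and \[ Q + 2\,\Re\, S^*N + N^*RN \geq 0, \] then $(A,B,M)$ is $\rho$-minimally stable.
   Context: Let $\ell_k$ denote the space of sequences indexed by $\mathbb{N}_{\ge0}$ with values in $\mathbb{R}^k$. $\mathcal{B}(A,B)=\{(x,u)\in\ell_{d+n}: x(k+1)=Ax(k)+Bu(k)\ \forall k\}$. A pair $(x,u)\in\ell_{d+n}$ belongs to $\mathrm{IQC}(M,\rho)$ if $\sum_{k=0}^N \rho^{-2k}\big(\langle Qx(k),x(k)\rangle + 2\langle Sx(k),u(k)\rangle + \langle Ru(k),u(k)\rangle\big)\ge 0$ for all $N\ge0$. The triple $(A,B,M)$ is $\rho$-minimally stable if for every $x_0\in\mathbb{R}^d$ there exists $(x,u)\in\mathcal{B}(A,B)\cap\mathrm{IQC}(M,\rho)$ with $x(0)=x_0$ and $\rho^{-k}x(k)\to0$ as $k\to\infty$. A square matrix is $\rho$-Schur if all its eigenvalues lie in the open disk of radius $\rho$. $\|R\|$ is the operator norm. *)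

theory Defs
  imports "HOL-Analysis.Analysis"
begin

text \<open>Behaviour of the linear system x(k+1) = A x(k) + B u(k).\<close>
definition behavior :: "real^'d^'d \<Rightarrow> real^'n^'d \<Rightarrow> (nat \<Rightarrow> real^'d) \<Rightarrow> (nat \<Rightarrow> real^'n) \<Rightarrow> bool" where
  "behavior A B x u \<longleftrightarrow> (\<forall>k. x (Suc k) = A *v x k + B *v u k)"

text \<open>IQC(M, rho) with M = [[Q, S^T],[S, R]].\<close>
definition IQC :: "real^'d^'d \<Rightarrow> real^'d^'n \<Rightarrow> real^'n^'n \<Rightarrow> real \<Rightarrow> (nat \<Rightarrow> real^'d) \<Rightarrow> (nat \<Rightarrow> real^'n) \<Rightarrow> bool" where
  "IQC Q S R \<rho> x u \<longleftrightarrow> (\<forall>N. 0 \<le> (\<Sum>k\<le>N. \<rho> powi (-2 * int k) *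
      ((Q *v x k) \<bullet> x k + 2 * ((S *v x k) \<bullet> u k) + (R *v u k) \<bullet> u k)))"

definition minimally_stable :: "real^'d^'d \<Rightarrow> real^'n^'d \<Rightarrow> real^'d^'d \<Rightarrow> real^'d^'n \<Rightarrow> real^'n^'n \<Rightarrow> real \<Rightarrow> bool" where
  "minimally_stable A B Q S R \<rho> \<longleftrightarrow> (\<forall>x0. \<exists>x u. behavior A B x u \<and> IQC Q S R \<rho> x u \<and> x 0 = x0 \<and>
      ((\<lambda>k. \<rho> powi (- int k) *\<^sub>R x k) \<longlonglongrightarrow> 0))"

text \<open>Complexification of a real matrix.\<close>
definition cmat :: "real^'m^'k \<Rightarrow> complex^'m^'k" where
  "cmat A = (\<chi> i j. complex_of_real (A $ i $ j))"

text \<open>rho-Schur: every (complex) eigenvalue lies in the open disk of radius rho.\<close>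
definition rho_schur :: "real \<Rightarrow> real^'d^'d \<Rightarrow> bool" where
  "rho_schur \<rho> A \<longleftrightarrow> (\<forall>z::complex. det (mat z - cmat A) = 0 \<longrightarrow> cmod z < \<rho>)"

definition psd :: "real^'d^'d \<Rightarrow> bool" where
  "psd P \<longleftrightarrow> (\<forall>x. 0 \<le> x \<bullet> (P *v x))"

end

(*
  The static feedback u = K x with K = (I + \<epsilon> R) N + \<epsilon> S turns the system into the
  closed loop x(k+1) = (A + B K) x(k), and A + B K is exactly the \<rho>-Schur matrix of the
  hypothesis. Its eigenvalues lie in a disk of some radius r < \<rho>, so the powers of
  (A + B K) / r are bounded (Jordan normal form), whence \<rho>^-k x(k) -> 0.

  With w = R N x + S x, the IQC supply rate at (x, K x) equals
    x' (Q + S' N + N' S + N' R N) x + \<epsilon> (2 |w|^2 + \<epsilon> w' R w),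
  where the first term is nonnegative by hypothesis and the second because \<epsilon> ||R|| <= 2.
  So every partial sum in the IQC is a sum of nonnegative terms.
*)

theory Submission
  imports Defs "Jordan_Normal_Form.Spectral_Radius"
begin

hide_const (open) Matrix.mat Determinant.det Matrix.vec
no_notation vec_index (infixl \<open>$\<close> 100)

section \<open>Transfer to Jordan normal form matrices\<close>

definition cart_index :: "'n::finite \<Rightarrow> nat" where
  "cart_index = (SOME h. bij_betw h UNIV {..<CARD('n)})"

definition index_cart :: "nat \<Rightarrow> 'n::finite" where
  "index_cart = the_inv_into UNIV cart_index"

lemma bij_betw_cart_index: "bij_betw (cart_index :: 'n::finite \<Rightarrow> nat) UNIV {..<CARD('n)}"
proof -
  have "\<exists>h. bij_betw h (UNIV :: 'n set) {..<CARD('n)}"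
    using ex_bij_betw_finite_nat[of "UNIV :: 'n set"] by (simp add: atLeast0LessThan)
  then show ?thesis
    unfolding cart_index_def by (rule someI_ex)
qed

lemma cart_index_less [simp]: "cart_index (j :: 'n::finite) < CARD('n)"
  using bij_betwE[OF bij_betw_cart_index] by blast

lemma index_cart_cart_index [simp]: "index_cart (cart_index (j :: 'n::finite)) = j"
  unfolding index_cart_def using bij_betw_cart_index[where 'n='n]
  by (simp add: bij_betw_def the_inv_into_f_f)

lemma cart_index_index_cart [simp]: "i < CARD('n::finite) \<Longrightarrow> cart_index (index_cart i :: 'n) = i"
  unfolding index_cart_def using bij_betw_cart_index[where 'n='n] f_the_inv_into_f_bij_betw
  by fastforce

lemma sum_cart_index: "(\<Sum>l<CARD('n::finite). g l) = (\<Sum>j\<in>(UNIV :: 'n set). g (cart_index j))"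
  using sum.reindex_bij_betw[OF bij_betw_cart_index[where 'n='n], of g] by simp

definition vec_of_cart :: "'a^'n::finite \<Rightarrow> 'a Matrix.vec" where
  "vec_of_cart v = Matrix.vec CARD('n) (\<lambda>i. v $ index_cart i)"

definition mat_of_cart :: "'a^'n::finite^'m::finite \<Rightarrow> 'a mat" where
  "mat_of_cart M = Matrix.mat CARD('m) CARD('n) (\<lambda>(i, j). M $ index_cart i $ index_cart j)"

lemma vec_of_cart_carrier [simp]: "vec_of_cart (v :: 'a^'n::finite) \<in> carrier_vec CARD('n)"
  by (simp add: vec_of_cart_def)

lemma mat_of_cart_carrier [simp]:
  "mat_of_cart (M :: 'a^'n::finite^'m::finite) \<in> carrier_mat CARD('m) CARD('n)"
  by (simp add: mat_of_cart_def)

lemma dim_mat_of_cart [simp]: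
  "dim_row (mat_of_cart (M :: 'a^'n::finite^'m::finite)) = CARD('m)"
  "dim_col (mat_of_cart (M :: 'a^'n::finite^'m::finite)) = CARD('n)"
  by (simp_all add: mat_of_cart_def)

lemma vec_of_cart_index [simp]: "vec_index (vec_of_cart v) (cart_index j) = v $ j"
  by (simp add: vec_of_cart_def)

lemma vec_of_cart_inject [simp]: "vec_of_cart u = vec_of_cart v \<longleftrightarrow> u = v"
  by (metis vec_of_cart_index Finite_Cartesian_Product.vec_eq_iff)

lemma vec_of_cart_zero [simp]: "vec_of_cart (0 :: 'a::zero^'n::finite) = 0\<^sub>v CARD('n)"
  by (rule eq_vecI) (simp_all add: vec_of_cart_def)

lemma vec_of_cart_scale: "vec_of_cart (c *s v) = c \<cdot>\<^sub>v vec_of_cart v"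
  by (rule eq_vecI) (simp_all add: vec_of_cart_def)

lemma vec_of_cart_surj:
  assumes "w \<in> carrier_vec CARD('n::finite)"
  shows "w = vec_of_cart (\<chi> j :: 'n. vec_index w (cart_index j))"
  using assms by (intro eq_vecI) (auto simp: vec_of_cart_def)

lemma vec_of_cart_mult:
  fixes M :: "'a::semiring_1^'n::finite^'m::finite"
  shows "vec_of_cart (M *v v) = mat_of_cart M *\<^sub>v vec_of_cart v"
proof (rule eq_vecI)
  fix i assume "i < dim_vec (mat_of_cart M *\<^sub>v vec_of_cart v)"
  then have i: "i < CARD('m)" by (simp add: mat_of_cart_def)
  have "vec_index (mat_of_cart M *\<^sub>v vec_of_cart v) i
      = (\<Sum>l<CARD('n). M $ index_cart i $ index_cart l * v $ index_cart l)"
    using i by (simp add: mult_mat_vec_def scalar_prod_def mat_of_cart_def vec_of_cart_def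
        atLeast0LessThan)
  also have "\<dots> = (\<Sum>j\<in>UNIV. M $ index_cart i $ j * v $ j)"
    by (simp add: sum_cart_index)
  finally show "vec_index (vec_of_cart (M *v v)) i
      = vec_index (mat_of_cart M *\<^sub>v vec_of_cart v) i"
    using i by (simp add: vec_of_cart_def matrix_vector_mult_def)
qed (simp add: vec_of_cart_def mat_of_cart_def)

lemma vec_of_cart_funpow:
  fixes M :: "'a::semiring_1^'n::finite^'n"
  shows "vec_of_cart (((*v) M ^^ k) v) = mat_of_cart M ^\<^sub>m k *\<^sub>v vec_of_cart v"
proof (induction k arbitrary: v)
  case 0
  then show ?case by simp
next
  case (Suc k)
  have "((*v) M ^^ Suc k) v = ((*v) M ^^ k) (M *v v)"
    by (simp add: funpow_Suc_right del: funpow.simps)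
  then have "vec_of_cart (((*v) M ^^ Suc k) v)
      = mat_of_cart M ^\<^sub>m k *\<^sub>v (mat_of_cart M *\<^sub>v vec_of_cart v)"
    by (simp add: Suc vec_of_cart_mult)
  also have "\<dots> = mat_of_cart M ^\<^sub>m Suc k *\<^sub>v vec_of_cart v"
    using assoc_mult_mat_vec[OF pow_carrier_mat[OF mat_of_cart_carrier[of M]]
        mat_of_cart_carrier[of M] vec_of_cart_carrier[of v]]
    by simp
  finally show ?case .
qed

lemma eigenvector_mat_of_cart_iff:
  fixes M :: "'a::comm_ring_1^'n::finite^'n"
  shows "eigenvector (mat_of_cart M) (vec_of_cart u) l \<longleftrightarrow> u \<noteq> 0 \<and> M *v u = l *s u"
  by (simp add: eigenvector_def vec_of_cart_mult[symmetric] vec_of_cart_scale[symmetric]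
      vec_of_cart_zero[symmetric] del: vec_of_cart_zero)

lemma eigenvalue_mat_of_cart_iff:
  fixes M :: "'a::comm_ring_1^'n::finite^'n"
  shows "eigenvalue (mat_of_cart M) l \<longleftrightarrow> (\<exists>u. u \<noteq> 0 \<and> M *v u = l *s u)"
  unfolding eigenvalue_def
  by (metis eigenvector_def eigenvector_mat_of_cart_iff vec_of_cart_surj mat_of_cart_carrier
      carrier_matD(1))

section \<open>\<rho>-Schur matrices\<close>

lemma matrix_vector_mul_mat: "(mat z :: 'a::semiring_1^'n::finite^'n) *v u = z *s u"
  by (simp add: Finite_Cartesian_Product.vec_eq_iff matrix_vector_mult_def
      Finite_Cartesian_Product.mat_def if_distrib[of "\<lambda>a. a * _"] sum.delta cong: if_cong)

lemma det_eq_0_iff_kernel: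
  fixes K :: "'a::field^'n::finite^'n"
  shows "det K = 0 \<longleftrightarrow> (\<exists>u. u \<noteq> 0 \<and> K *v u = 0)"
proof -
  have "det K \<noteq> 0 \<longleftrightarrow> inj ((*v) K)"
    using det_nz_iff_inj_gen[of "(*v) K"]
    by (simp add: matrix_vector_mul_linear_gen matrix_of_matrix_vector_mul)
  also have "\<dots> \<longleftrightarrow> (\<forall>u. K *v u = 0 \<longrightarrow> u = 0)"
    unfolding inj_def
    by (metis matrix_vector_mult_0_right matrix_vector_mult_diff_distrib right_minus_eq)
  finally show ?thesis by blast
qed

lemma rho_schur_iff_eigenvalue:
  "rho_schur \<rho> C \<longleftrightarrow> (\<forall>z. eigenvalue (mat_of_cart (cmat C)) z \<longrightarrow> cmod z < \<rho>)"
proof -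
  have "det (mat z - cmat C) = 0 \<longleftrightarrow> eigenvalue (mat_of_cart (cmat C)) z" for z
    unfolding det_eq_0_iff_kernel eigenvalue_mat_of_cart_iff
    by (simp add: matrix_vector_mult_diff_rdistrib matrix_vector_mul_mat eq_commute[of "z *s _"])
  then show ?thesis
    unfolding rho_schur_def by blast
qed

lemma rho_schur_iff_spectral_radius:
  "rho_schur \<rho> C \<longleftrightarrow> spectral_radius (mat_of_cart (cmat C)) < \<rho>"
proof -
  let ?A = "mat_of_cart (cmat C)"
  have "(\<forall>z. eigenvalue ?A z \<longrightarrow> cmod z < \<rho>) \<longleftrightarrow> spectral_radius ?A < \<rho>"
    using spectral_radius_mem_max[OF mat_of_cart_carrier[of "cmat C"] zero_less_card_finite]
    unfolding spectrum_def by fastforce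
  then show ?thesis
    by (simp add: rho_schur_iff_eigenvalue)
qed

lemma cmat_scaleR_mult: "cmat (c *\<^sub>R M) *v u = complex_of_real c *s (cmat M *v u)"
  by (simp add: Finite_Cartesian_Product.vec_eq_iff cmat_def matrix_vector_mult_def
      sum_distrib_left algebra_simps)

lemma rho_schur_scaleR:
  assumes "rho_schur \<rho> C" and "0 < c"
  shows "rho_schur (c * \<rho>) (c *\<^sub>R C)"
  unfolding rho_schur_iff_eigenvalue eigenvalue_mat_of_cart_iff
proof (intro allI impI)
  fix z assume "\<exists>u. u \<noteq> 0 \<and> cmat (c *\<^sub>R C) *v u = z *s u"
  then obtain u where u: "u \<noteq> 0" "complex_of_real c *s (cmat C *v u) = z *s u"
    by (auto simp: cmat_scaleR_mult)
  have "cmat C *v u = inverse (complex_of_real c) *s (complex_of_real c *s (cmat C *v u))"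
    using \<open>0 < c\<close> by (simp add: vector_smult_assoc)
  also have "\<dots> = (z / complex_of_real c) *s u"
    by (simp add: u(2) vector_smult_assoc divide_inverse mult.commute)
  finally have "cmod (z / complex_of_real c) < \<rho>"
    using assms(1) u(1) unfolding rho_schur_iff_eigenvalue eigenvalue_mat_of_cart_iff by blast
  then show "cmod z < c * \<rho>"
    using \<open>0 < c\<close> by (simp add: norm_divide pos_divide_less_eq mult.commute)
qed

lemma rho_schur_smaller_radius:
  assumes "rho_schur \<rho> C"
  obtains r where "0 < r" "r < \<rho>" "rho_schur r C"
proof -
  let ?s = "spectral_radius (mat_of_cart (cmat C))"
  have "0 \<le> ?s"
    using spectral_radius_mem_max(1)[OF mat_of_cart_carrier[of "cmat C"] zero_less_card_finite]
    by auto
  moreover have "?s < \<rho>"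
    using assms by (simp add: rho_schur_iff_spectral_radius)
  ultimately show ?thesis
    using that[of "(?s + \<rho>) / 2"] by (simp add: rho_schur_iff_spectral_radius)
qed

lemma spectral_radius_less_1_orbit_bounded:
  fixes M :: "complex^'n::finite^'n"
  assumes "spectral_radius (mat_of_cart M) < 1"
  obtains B where "\<And>k. norm (((*v) M ^^ k) u) \<le> B"
proof -
  obtain c where c: "\<And>k. norm_bound (mat_of_cart M ^\<^sub>m k) c"
    using spectral_radius_jnf_norm_bound_less_1_upper_triangular[OF mat_of_cart_carrier assms]
    by blast
  define W where "W = (\<Sum>l<CARD('n). cmod (vec_index (vec_of_cart u) l))"
  have component: "cmod (((*v) M ^^ k) u $ j) \<le> c * W" for k j
  proof -
    let ?P = "mat_of_cart M ^\<^sub>m k"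
    have "((*v) M ^^ k) u $ j = vec_index (?P *\<^sub>v vec_of_cart u) (cart_index j)"
      by (simp flip: vec_of_cart_funpow)
    also have "\<dots> = (\<Sum>l<CARD('n). ?P $$ (cart_index j, l) * vec_index (vec_of_cart u) l)"
      by (auto simp: mult_mat_vec_def scalar_prod_def atLeast0LessThan intro!: sum.cong)
    also have "cmod \<dots>
        \<le> (\<Sum>l<CARD('n). cmod (?P $$ (cart_index j, l)) * cmod (vec_index (vec_of_cart u) l))"
      by (metis (no_types, lifting) norm_mult norm_sum sum.cong)
    also have "\<dots> \<le> (\<Sum>l<CARD('n). c * cmod (vec_index (vec_of_cart u) l))"
      using c[of k] by (intro sum_mono mult_right_mono) (auto simp: norm_bound_def)
    finally show ?thesis
      by (simp add: W_def sum_distrib_left)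
  qed
  have "norm (((*v) M ^^ k) u) \<le> CARD('n) * (c * W)" for k
  proof -
    have "norm (((*v) M ^^ k) u) \<le> (\<Sum>j\<in>UNIV. cmod (((*v) M ^^ k) u $ j))"
      unfolding norm_vec_def by (rule L2_set_le_sum) simp
    also have "\<dots> \<le> (\<Sum>j\<in>(UNIV :: 'n set). c * W)"
      by (intro sum_mono component)
    finally show ?thesis by simp
  qed
  then show ?thesis using that by blast
qed

definition cvec :: "real^'n \<Rightarrow> complex^'n" where
  "cvec x = (\<chi> i. complex_of_real (x $ i))"

lemma cmat_mult_cvec: "cmat M *v cvec x = cvec (M *v x)"
  by (simp add: Finite_Cartesian_Product.vec_eq_iff cmat_def cvec_def matrix_vector_mult_def)

lemma norm_cvec [simp]: "norm (cvec x) = norm x"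
  by (simp add: norm_vec_def cvec_def)

lemma rho_schur_1_orbit_bounded:
  assumes "rho_schur 1 C"
  obtains B where "\<And>k. norm (((*v) C ^^ k) x) \<le> B"
proof -
  have "((*v) (cmat C) ^^ k) (cvec x) = cvec (((*v) C ^^ k) x)" for k
    by (induction k) (simp_all add: cmat_mult_cvec)
  moreover obtain B where "\<And>k. norm (((*v) (cmat C) ^^ k) (cvec x)) \<le> B"
    using spectral_radius_less_1_orbit_bounded assms rho_schur_iff_spectral_radius by metis
  ultimately show ?thesis
    using that by (metis norm_cvec)
qed

lemma funpow_scaleR_matrix:
  fixes M :: "real^'n::finite^'n"
  shows "((*v) (c *\<^sub>R M) ^^ k) x = c ^ k *\<^sub>R ((*v) M ^^ k) x"
  by (induction k) (simp_all add: scaleR_matrix_vector_assoc[symmetric] matrix_vector_mult_scaleR)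

lemma rho_schur_orbit_decay:
  assumes "rho_schur \<rho> C"
  shows "(\<lambda>k. \<rho> powi (- int k) *\<^sub>R ((*v) C ^^ k) x) \<longlonglongrightarrow> 0"
proof -
  obtain r where r: "0 < r" "r < \<rho>" "rho_schur r C"
    using rho_schur_smaller_radius assms by blast
  have "rho_schur 1 ((1 / r) *\<^sub>R C)"
    using rho_schur_scaleR[OF r(3), of "1 / r"] r(1) by simp
  then obtain B where B: "\<And>k. norm (((*v) ((1 / r) *\<^sub>R C) ^^ k) x) \<le> B"
    using rho_schur_1_orbit_bounded by blast
  have orbit: "\<rho> powi (- int k) *\<^sub>R ((*v) C ^^ k) x
      = (r / \<rho>) ^ k *\<^sub>R ((*v) ((1 / r) *\<^sub>R C) ^^ k) x" for k
  proof -
    have "((*v) C ^^ k) x = r ^ k *\<^sub>R ((*v) ((1 / r) *\<^sub>R C) ^^ k) x"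
      using funpow_scaleR_matrix[where c = r and M = "(1 / r) *\<^sub>R C"] r(1) by simp
    then show ?thesis
      by (simp add: power_int_minus power_divide field_simps)
  qed
  show ?thesis
  proof (rule Lim_null_comparison)
    show "\<forall>\<^sub>F k in sequentially.
        norm (\<rho> powi (- int k) *\<^sub>R ((*v) C ^^ k) x) \<le> B * (r / \<rho>) ^ k"
      using B r by (intro always_eventually allI) (simp add: orbit mult.commute mult_left_mono)
    show "(\<lambda>k. B * (r / \<rho>) ^ k) \<longlonglongrightarrow> 0"
      using r by (intro tendsto_mult_right_zero LIMSEQ_power_zero) auto
  qed
qed

section \<open>The IQC supply rate under static feedback\<close>

definition iqc_form ::
    "real^'d^'d \<Rightarrow> real^'d^'n \<Rightarrow> real^'n^'n \<Rightarrow> real^'d \<Rightarrow> real^'n \<Rightarrow> real" where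
  "iqc_form Q S R x u = (Q *v x) \<bullet> x + 2 * ((S *v x) \<bullet> u) + (R *v u) \<bullet> u"

lemma IQC_if_iqc_form_nonneg:
  assumes "\<And>k. 0 \<le> iqc_form Q S R (x k) (u k)"
  shows "IQC Q S R \<rho> x u"
proof -
  have "0 \<le> \<rho> powi (-2 * int k)" for k
    by (simp add: power_int_minus mult.commute[of 2] power_int_mult)
  then show ?thesis
    unfolding IQC_def iqc_form_def[symmetric] using assms by (simp add: sum_nonneg)
qed

lemma inner_transpose_mult: "x \<bullet> (transpose M *v y) = (M *v x) \<bullet> (y :: real^'n::finite)"
  by (metis dot_lmul_matrix inner_commute transpose_matrix_vector)

lemma inner_symmetric_matrix:
  assumes "transpose R = R"
  shows "(R *v a) \<bullet> b = (R *v b) \<bullet> (a :: real^'n::finite)"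
  by (metis assms inner_commute inner_transpose_mult)

lemma iqc_form_linear_feedback:
  "iqc_form Q S R x (N *v x)
     = x \<bullet> ((Q + transpose S ** N + transpose N ** S + transpose N ** R ** N) *v x)"
  by (simp only: iqc_form_def matrix_vector_mult_add_rdistrib inner_add_right
      matrix_vector_mul_assoc[symmetric] inner_transpose_mult)
    (simp add: inner_commute[of x "Q *v x"] inner_commute[of "N *v x"])

lemma iqc_form_shift:
  assumes "transpose R = R" and "w = R *v n + S *v x"
  shows "iqc_form Q S R x (n + e *\<^sub>R w)
     = iqc_form Q S R x n + e * (2 * (w \<bullet> w) + e * ((R *v w) \<bullet> w))"
proof -
  have "w \<bullet> w = (R *v n) \<bullet> w + (S *v x) \<bullet> w"
    using assms(2) by (simp add: inner_add_left)
  then show ?thesis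
    unfolding iqc_form_def
    by (simp add: matrix_vector_right_distrib matrix_vector_mult_scaleR inner_add_left
        inner_add_right inner_symmetric_matrix[OF assms(1), of w n] algebra_simps)
qed

lemma inner_matrix_mult_abs_le_onorm:
  fixes R :: "real^'n::finite^'n"
  shows "\<bar>(R *v w) \<bullet> w\<bar> \<le> onorm ((*v) R) * norm w ^ 2"
proof -
  have "\<bar>(R *v w) \<bullet> w\<bar> \<le> norm (R *v w) * norm w"
    by (rule Cauchy_Schwarz_ineq2)
  also have "\<dots> \<le> onorm ((*v) R) * norm w * norm w"
    using onorm[OF matrix_vector_mul_bounded_linear, of R w] by (simp add: mult_right_mono)
  finally show ?thesis
    by (simp add: power2_eq_square mult.assoc)
qed

lemma two_inner_plus_quadratic_nonneg:
  fixes R :: "real^'n::finite^'n"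
  assumes "0 \<le> e" and "e * onorm ((*v) R) \<le> 2"
  shows "0 \<le> 2 * (w \<bullet> w) + e * ((R *v w) \<bullet> w)"
proof -
  have "e * - ((R *v w) \<bullet> w) \<le> e * (onorm ((*v) R) * norm w ^ 2)"
    using inner_matrix_mult_abs_le_onorm[of R w] assms(1) by (intro mult_left_mono) auto
  also have "\<dots> \<le> 2 * norm w ^ 2"
    using assms(2) by (simp add: mult.assoc[symmetric] mult_right_mono)
  finally show ?thesis
    by (simp add: power2_norm_eq_inner)
qed

lemma iqc_form_nonneg_perturbed_feedback:
  assumes "transpose R = R" and "0 \<le> e" and "e * onorm ((*v) R) \<le> 2"
    and "psd (Q + transpose S ** N + transpose N ** S + transpose N ** R ** N)"
  shows "0 \<le> iqc_form Q S R x (((mat 1 + e *\<^sub>R R) ** N + e *\<^sub>R S) *v x)"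
proof -
  define w where "w = R *v (N *v x) + S *v x"
  have "((mat 1 + e *\<^sub>R R) ** N + e *\<^sub>R S) *v x = N *v x + e *\<^sub>R w"
    by (simp add: w_def matrix_vector_mult_add_rdistrib matrix_vector_mul_assoc[symmetric]
        scaleR_matrix_vector_assoc algebra_simps)
  then have "iqc_form Q S R x (((mat 1 + e *\<^sub>R R) ** N + e *\<^sub>R S) *v x)
      = x \<bullet> ((Q + transpose S ** N + transpose N ** S + transpose N ** R ** N) *v x)
        + e * (2 * (w \<bullet> w) + e * ((R *v w) \<bullet> w))"
    using iqc_form_shift[OF assms(1) w_def] by (simp add: iqc_form_linear_feedback)
  moreover have "0 \<le> x \<bullet> ((Q + transpose S ** N + transpose N ** S + transpose N ** R ** N) *v x)"
    using assms(4) by (simp add: psd_def)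
  moreover have "0 \<le> e * (2 * (w \<bullet> w) + e * ((R *v w) \<bullet> w))"
    using two_inner_plus_quadratic_nonneg[OF assms(2,3)] assms(2) by simp
  ultimately show ?thesis
    by linarith
qed

lemma minimally_stable_if_stabilizing_feedback:
  assumes "rho_schur \<rho> (A + B ** K)" and "\<And>x. 0 \<le> iqc_form Q S R x (K *v x)"
  shows "minimally_stable A B Q S R \<rho>"
  unfolding minimally_stable_def
proof
  fix x0
  define x where "x k = ((*v) (A + B ** K) ^^ k) x0" for k
  have "behavior A B x (\<lambda>k. K *v x k)"
    by (simp add: behavior_def x_def matrix_vector_mult_add_rdistrib matrix_vector_mul_assoc)
  moreover have "IQC Q S R \<rho> x (\<lambda>k. K *v x k)"
    using assms(2) by (rule IQC_if_iqc_form_nonneg)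
  moreover have "x 0 = x0"
    by (simp add: x_def)
  moreover have "(\<lambda>k. \<rho> powi (- int k) *\<^sub>R x k) \<longlonglongrightarrow> 0"
    unfolding x_def by (rule rho_schur_orbit_decay[OF assms(1)])
  ultimately show "\<exists>x u. behavior A B x u \<and> IQC Q S R \<rho> x u \<and> x 0 = x0 \<and>
      (\<lambda>k. \<rho> powi (- int k) *\<^sub>R x k) \<longlonglongrightarrow> 0"
    by blast
qed

theorem lemma2p4:
  fixes A :: "real^'d^'d" and B :: "real^'n^'d" and Q :: "real^'d^'d"
    and S :: "real^'d^'n" and R :: "real^'n^'n" and \<rho> :: real
  assumes "\<rho> > 0"
    and "transpose Q = Q" and "transpose R = R"
    and "\<exists>(N :: real^'d^'n) (\<epsilon>::real). 0 \<le> \<epsilon> \<and> \<epsilon> * onorm (\<lambda>v. R *v v) \<le> 2 \<and>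
           rho_schur \<rho> (A + B ** (mat 1 + \<epsilon> *\<^sub>R R) ** N + \<epsilon> *\<^sub>R (B ** S)) \<and>
           psd (Q + transpose S ** N + transpose N ** S + transpose N ** R ** N)"
  shows "minimally_stable A B Q S R \<rho>"
proof -
  obtain N :: "real^'d^'n" and e :: real where e: "0 \<le> e" "e * onorm ((*v) R) \<le> 2"
    and schur: "rho_schur \<rho> (A + B ** (mat 1 + e *\<^sub>R R) ** N + e *\<^sub>R (B ** S))"
    and psd: "psd (Q + transpose S ** N + transpose N ** S + transpose N ** R ** N)"
    using assms(4) by blast
  define K where "K = (mat 1 + e *\<^sub>R R) ** N + e *\<^sub>R S"
  show ?thesis
  proof (rule minimally_stable_if_stabilizing_feedback)
    have "A + B ** K = A + B ** (mat 1 + e *\<^sub>R R) ** N + e *\<^sub>R (B ** S)"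
      by (simp add: K_def matrix_add_ldistrib matrix_mul_assoc matrix_scalar_ac scalar_matrix_assoc)
    with schur show "rho_schur \<rho> (A + B ** K)"
      by (simp only:)
    show "0 \<le> iqc_form Q S R x (K *v x)" for x
      unfolding K_def by (rule iqc_form_nonneg_perturbed_feedback[OF assms(3) e psd])
  qed
qed

end
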